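(* Let $k\ge 0$ and suppose that - $f,g_1,\dots,g_m$ are $C^1$ vector functions, and - for all $i=1,\dots,m$, $w_i$ is a bounded measurable function on $[t_k,t_{k+1}]$ satisfying $$\int_{t_k}^{t_{k+1}}\bigl(v_i(t)-w_i(t)\bigr)\,dt=0.$$ Let $x$ and $y$ be solutions on $[t_k,t_{k+1}]$ of the input-affine system with inputs $v_i$ and of the auxiliary system with inputs $w_i$ respectively, with $x(t_k)=y(t_k)$. Then the local error $\|x(t_{k+1})-y(t_{k+1})\|$ is $O(h^2)$.
   Context: Setting. The input-affine system is $$\dot x(t)=f(x(t))+\sum_{i=1}^m g_i(x(t))\,v_i(t),$$ where $f,g_1,\dots,g_m:\mathbb{R}^n\to\mathbb{R}^n$ and each $v_i$ is an arbitrary measurable function with $v_i(t)\in[-V_i,V_i]$, $V_i>0$. Solutions are absolutely continuous functions satisfying the equation for almost every $t$. The interval $[0,T]$ is partitioned as $0=t_0<t_1<\dots<t_N=T$ and $h_k=t_{k+1}-t_k$. On $[t_k,t_{k+1}]$ the auxiliary system is $$\dot y(t)=f(y(t))+\sum_{i=1}^m g_i(y(t))\,w_i(t),\qquad y(t_k)=x(t_k).$$ Bounds. $\|\cdot\|$ is the supremum norm on $\mathbb{R}^n$ and the induced matrix norm. $B\subset\mathbb{R}^n$ is a box containing the values on $[0,T]$ of all solutions under consideration of both systems (for all admissible inputs). There are constants such that for all $z\in B$, all $t$ and all $i$: $|v_i(t)|\le V_i$, $|w_i(t)|\le rV_i$, $\|f(z)\|\le K$, $\|g_i(z)\|\le K_i$,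 $\|Df(z)\|\le L$, $\|Dg_i(z)\|\le L_i$. "Local error is $O(h^2)$" means bounded by $C h_k^2$ with $C$ depending only on $m$, $T$ and the constants above, not on $k$ or on the particular inputs $v_i,w_i$. *)

theory Defs
  imports "HOL-Analysis.Analysis"
begin

text \<open>
  The error constant must not depend on the dimension \<open>n\<close>, so \<open>n\<close> has to be quantified inside
  the statement and cannot be the cardinality of an index type.  Hence \<open>\<real>\<^sup>n\<close> is the set of
  functions on \<open>{..<n}\<close>, extended by \<open>undefined\<close> as usual for \<^const>\<open>PiE\<close>.  As a subspace of the
  product topology on \<^typ>\<open>nat \<Rightarrow> real\<close> it carries the Euclidean topology.
\<close>

definition Rn :: "nat \<Rightarrow> (nat \<Rightarrow> real) set" where
  "Rn n = {..<n} \<rightarrow>\<^sub>E UNIV"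

text \<open>Meaningful for \<open>n \<ge> 1\<close>.\<close>

definition sup_norm :: "nat \<Rightarrow> (nat \<Rightarrow> real) \<Rightarrow> real" where
  "sup_norm n z = (MAX i\<in>{..<n}. \<bar>z i\<bar>)"

definition mat_vec :: "nat \<Rightarrow> (nat \<Rightarrow> nat \<Rightarrow> real) \<Rightarrow> (nat \<Rightarrow> real) \<Rightarrow> nat \<Rightarrow> real" where
  "mat_vec n A u = (\<lambda>i. \<Sum>j<n. A i j * u j)"

definition mat_norm :: "nat \<Rightarrow> (nat \<Rightarrow> nat \<Rightarrow> real) \<Rightarrow> real" where
  "mat_norm n A = (SUP u\<in>{u \<in> Rn n. sup_norm n u \<le> 1}. sup_norm n (mat_vec n A u))"

definition Jacobian :: "((nat \<Rightarrow> real) \<Rightarrow> nat \<Rightarrow> real) \<Rightarrow> (nat \<Rightarrow> real) \<Rightarrow> nat \<Rightarrow> nat \<Rightarrow> real" where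
  "Jacobian F z = (\<lambda>i j. deriv (\<lambda>s. F (z(j := s)) i) (z j))"

text \<open>\<open>C\<^sup>1\<close> vector fields: all partial derivatives exist and are continuous on the whole space.\<close>

definition C1_field :: "nat \<Rightarrow> ((nat \<Rightarrow> real) \<Rightarrow> nat \<Rightarrow> real) \<Rightarrow> bool" where
  "C1_field n F \<longleftrightarrow>
     F \<in> Rn n \<rightarrow> Rn n \<and>
     (\<forall>i<n. \<forall>j<n.
        (\<forall>z\<in>Rn n. (\<lambda>s. F (z(j := s)) i) differentiable at (z j)) \<and>
        continuous_on (Rn n) (\<lambda>z. Jacobian F z i j))"

text \<open>
  A pair \<open>(u, v)\<close> stands for the interval from \<open>u\<close> to \<open>v\<close>; only the interiors have to be disjoint,
  so neighbouring intervals may share an endpoint.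
\<close>

definition abs_cont_on :: "real \<Rightarrow> real \<Rightarrow> (real \<Rightarrow> real) \<Rightarrow> bool" where
  "abs_cont_on a b \<phi> \<longleftrightarrow>
     (\<forall>\<epsilon>>0. \<exists>\<delta>>0. \<forall>D.
        finite D \<longrightarrow>
        (\<forall>(u, v)\<in>D. a \<le> u \<and> u \<le> v \<and> v \<le> b) \<longrightarrow>
        disjoint_family_on (\<lambda>(u, v). {u<..<v}) D \<longrightarrow>
        (\<Sum>(u, v)\<in>D. v - u) < \<delta> \<longrightarrow>
        (\<Sum>(u, v)\<in>D. \<bar>\<phi> v - \<phi> u\<bar>) < \<epsilon>)"

definition solves_on ::
  "nat \<Rightarrow> nat \<Rightarrow> ((nat \<Rightarrow> real) \<Rightarrow> nat \<Rightarrow> real) \<Rightarrow> (nat \<Rightarrow> (nat \<Rightarrow> real) \<Rightarrow> nat \<Rightarrow> real) \<Rightarrow>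
   (nat \<Rightarrow> real \<Rightarrow> real) \<Rightarrow> real \<Rightarrow> real \<Rightarrow> (real \<Rightarrow> nat \<Rightarrow> real) \<Rightarrow> bool" where
  "solves_on n m f g v a b x \<longleftrightarrow>
     x \<in> {a..b} \<rightarrow> Rn n \<and>
     (\<forall>j<n. abs_cont_on a b (\<lambda>s. x s j)) \<and>
     (AE s in lebesgue_on {a..b}. \<forall>j<n.
        ((\<lambda>\<tau>. x \<tau> j) has_real_derivative f (x s) j + (\<Sum>i=1..m. g i (x s) j * v i s))
          (at s within {a..b}))"

definition is_partition :: "real \<Rightarrow> nat \<Rightarrow> (nat \<Rightarrow> real) \<Rightarrow> bool" where
  "is_partition T N t \<longleftrightarrow> t 0 = 0 \<and> t N = T \<and> (\<forall>k<N. t k < t (Suc k))"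

definition is_input :: "real \<Rightarrow> real \<Rightarrow> real \<Rightarrow> (real \<Rightarrow> real) \<Rightarrow> bool" where
  "is_input a b M u \<longleftrightarrow>
     u \<in> borel_measurable (lebesgue_on {a..b}) \<and> (\<forall>s\<in>{a..b}. \<bar>u s\<bar> \<le> M)"

definition is_box :: "nat \<Rightarrow> (nat \<Rightarrow> real) set \<Rightarrow> bool" where
  "is_box n B \<longleftrightarrow> (\<exists>a b. B = (\<Pi>\<^sub>E i\<in>{..<n}. {a i..b i}))"

end

theory Submission
  imports Defs
begin

text \<open>
  Write \<open>h = t\<^sub>k\<^sub>+\<^sub>1 - t\<^sub>k\<close> and \<open>a = t\<^sub>k\<close>.  Both right-hand sides are bounded, so on the whole step
  \<open>x\<close> and \<open>y\<close> stay within \<open>O(h)\<close> of their common initial value \<open>x(a)\<close>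
  (\<open>solves_on_increment_le\<close>).  Now split
  \<open>g\<^sub>i(x) v\<^sub>i - g\<^sub>i(y) w\<^sub>i\<close> into
  \<open>(g\<^sub>i(x) - g\<^sub>i(x(a))) v\<^sub>i - (g\<^sub>i(y) - g\<^sub>i(x(a))) w\<^sub>i + g\<^sub>i(x(a)) (v\<^sub>i - w\<^sub>i)\<close>.
  The last summand has a constant factor, so its integral over the step vanishes by the hypothesis
  on the inputs.  The other two summands and \<open>f(x) - f(y)\<close> are \<open>O(h)\<close> pointwise because the fields
  are Lipschitz on the box.  Integrating an \<open>O(h)\<close> quantity over a step of length \<open>h\<close> gives
  \<open>O(h\<^sup>2)\<close> (\<open>local_error_component\<close>).

  Two analytic facts carry this.  The first is the fundamental theorem of calculus for absolutely
  continuous functions (\<open>abs_cont_has_integral\<close>).  It is stated for the gauge integral, for which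
  integrability of the derivative is part of the conclusion, in particular that of the velocities
  along \<open>x\<close> and \<open>y\<close>.  The second is the Lipschitz bound on a box
  whose constant is the bound on the \<^emph>\<open>induced\<close> norm of the Jacobian
  (\<open>C1_field_Lipschitz_on_box\<close>).  Changing one coordinate at a time would evaluate the partial
  derivatives at different points and cost a factor \<open>n\<close>, which the error constant does not allow.
  Hence the chain rule along a segment is derived first, and the mean value theorem is applied to
  the segment as a whole.
\<close>

section \<open>The fundamental theorem of calculus for absolutely continuous functions\<close>

lemma abs_cont_on_subinterval:
  assumes "abs_cont_on a b \<phi>" and "a \<le> c" "d \<le> b"
  shows "abs_cont_on c d \<phi>"
  unfolding abs_cont_on_def
proof (intro allI impI)
  fix e :: real assume "e > 0"
  then obtain \<delta> where "\<delta> > 0" and \<delta>: "\<And>D. finite D \<Longrightarrow> (\<forall>(u, v)\<in>D. a \<le> u \<and> u \<le> v \<and> v \<le> b) \<Longrightarrow>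
        disjoint_family_on (\<lambda>(u, v). {u<..<v}) D \<Longrightarrow> (\<Sum>(u, v)\<in>D. v - u) < \<delta> \<Longrightarrow>
        (\<Sum>(u, v)\<in>D. \<bar>\<phi> v - \<phi> u\<bar>) < e"
    using assms(1) unfolding abs_cont_on_def by meson
  show "\<exists>\<delta>>0. \<forall>D. finite D \<longrightarrow> (\<forall>(u, v)\<in>D. c \<le> u \<and> u \<le> v \<and> v \<le> d) \<longrightarrow>
        disjoint_family_on (\<lambda>(u, v). {u<..<v}) D \<longrightarrow> (\<Sum>(u, v)\<in>D. v - u) < \<delta> \<longrightarrow>
        (\<Sum>(u, v)\<in>D. \<bar>\<phi> v - \<phi> u\<bar>) < e"
  proof (intro exI conjI allI impI)
    fix D assume D: "finite D" "\<forall>(u, v)\<in>D. c \<le> u \<and> u \<le> v \<and> v \<le> d"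
      "disjoint_family_on (\<lambda>(u, v). {u<..<v}) D" "(\<Sum>(u, v)\<in>D. v - u) < \<delta>"
    have "\<forall>(u, v)\<in>D. a \<le> u \<and> u \<le> v \<and> v \<le> b"
      using D(2) assms(2,3) by force
    with D show "(\<Sum>(u, v)\<in>D. \<bar>\<phi> v - \<phi> u\<bar>) < e"
      by (intro \<delta>) auto
  qed fact
qed

text \<open>
  Turns the defining property of absolute continuity, which speaks of sets of pairs, into a
  statement about a part \<open>q\<close> of a tagged division: the intervals of \<open>q\<close> do not overlap, so their
  total length is at most the measure of a set \<open>T\<close> that contains them.  Several members of \<open>q\<close>
  could a priori give the same pair of endpoints; non-overlapping excludes this for nondegenerate
  intervals, and degenerate ones contribute nothing.
\<close>
lemma abs_cont_on_sum_tagged_lt: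
  assumes p: "p tagged_division_of {a..b}" and q: "q \<subseteq> p"
    and T: "T \<in> lmeasurable" "measure lebesgue T < \<delta>" "\<And>s K. (s, K) \<in> q \<Longrightarrow> K \<subseteq> T"
    and \<delta>: "\<And>D. finite D \<Longrightarrow> (\<forall>(u, v)\<in>D. a \<le> u \<and> u \<le> v \<and> v \<le> b) \<Longrightarrow>
        disjoint_family_on (\<lambda>(u, v). {u<..<v}) D \<Longrightarrow> (\<Sum>(u, v)\<in>D. v - u) < \<delta> \<Longrightarrow>
        (\<Sum>(u, v)\<in>D. \<bar>\<phi> v - \<phi> u\<bar>) < e"
  shows "(\<Sum>(s, K)\<in>q. \<bar>\<phi> (Sup K) - \<phi> (Inf K)\<bar>) < (e::real)"
proof -
  have fin: "finite q"
    using p q by (meson finite_subset tagged_division_ofD(1))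
  have iv: "\<exists>u v. K = {u..v} \<and> u \<le> v \<and> a \<le> u \<and> v \<le> b" if "(s, K) \<in> q" for s K
  proof -
    have "(s, K) \<in> p" using q that by blast
    then obtain u v where "K = cbox u v" "s \<in> K" "K \<subseteq> {a..b}"
      using tagged_division_ofD[OF p] by metis
    then show ?thesis by (intro exI[of _ u] exI[of _ v]) auto
  qed
  \<comment> \<open>On nondegenerate intervals, passing to the pair of endpoints is injective.\<close>
  define q' where "q' = {(s, K) \<in> q. Inf K < Sup K}"
  define E where "E = (\<lambda>(s::real, K::real set). (Inf K, Sup K))"
  have q': "finite q'" "q' \<subseteq> q"
    using fin by (auto simp: q'_def intro: finite_subset)
  have disj: "K \<inter> K' = {}" if "(s, L) \<in> q'" "(s', L') \<in> q'" "(s, L) \<noteq> (s', L')"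
     "K = {Inf L<..<Sup L}" "K' = {Inf L'<..<Sup L'}" for s L s' L' K K'
  proof -
    have "interior L \<inter> interior L' = {}"
      using tagged_division_ofD(5)[OF p] that q q'(2) by blast
    moreover have "interior M = {Inf M<..<Sup M}" if cM: "(c, M) \<in> q'" for c M
    proof -
      obtain u v where "M = {u..v}" "u \<le> v" using iv[of c M] cM q'(2) by blast
      then show ?thesis by (simp add: interior_atLeastAtMost_real)
    qed
    ultimately show ?thesis using that by metis
  qed
  have inj: "inj_on E q'"
  proof (rule inj_onI, rule ccontr)
    fix c c' assume c: "c \<in> q'" "c' \<in> q'" "E c = E c'" "c \<noteq> c'"
    obtain s K s' K' where eq: "c = (s, K)" "c' = (s', K')"
      by (cases c, cases c') auto
    have "{Inf K<..<Sup K} \<inter> {Inf K'<..<Sup K'} = {}"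
      using disj[of s K s' K'] c eq by auto
    moreover have "Inf K < Sup K" using c(1) eq by (auto simp: q'_def)
    ultimately show False using c(3) eq by (auto simp: E_def)
  qed
  define D where "D = E ` q'"
  have D1: "finite D" by (simp add: D_def q')
  have D2: "\<forall>(u, v)\<in>D. a \<le> u \<and> u \<le> v \<and> v \<le> b"
  proof -
    have "a \<le> Inf K \<and> Inf K \<le> Sup K \<and> Sup K \<le> b" if "(s, K) \<in> q'" for s K
    proof -
      obtain u v where "K = {u..v}" "u \<le> v" "a \<le> u" "v \<le> b"
        using iv \<open>(s, K) \<in> q'\<close> q'(2) by blast
      then show ?thesis by simp
    qed
    then show ?thesis by (auto simp: D_def E_def)
  qed
  have D3: "disjoint_family_on (\<lambda>(u, v). {u<..<v}) D"
    unfolding disjoint_family_on_def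
  proof (intro ballI impI)
    fix c c' assume c: "c \<in> D" "c' \<in> D" "c \<noteq> c'"
    then obtain s K s' K' where "(s, K) \<in> q'" "c = (Inf K, Sup K)" "(s', K') \<in> q'" "c' = (Inf K', Sup K')"
      by (auto simp: D_def E_def)
    with c show "(case c of (u, v) \<Rightarrow> {u<..<v}) \<inter> (case c' of (u, v) \<Rightarrow> {u<..<v}) = {}"
      using disj[of s K s' K'] by auto
  qed
  have sub: "{u<..<v} \<subseteq> T" if "(u, v) \<in> D" for u v
  proof -
    from that obtain s K where sK: "(s, K) \<in> q'" "u = Inf K" "v = Sup K"
      by (auto simp: D_def E_def)
    then obtain u' v' where "K = {u'..v'}" "u' \<le> v'"
      using iv q'(2) by blast
    then have "{u<..<v} \<subseteq> K"
      using sK by auto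
    then show ?thesis using T(3)[of s K] sK q'(2) by blast
  qed
  have "(\<Sum>(u, v)\<in>D. v - u) = (\<Sum>c\<in>D. measure lebesgue (case c of (u, v) \<Rightarrow> {u<..<v}))"
    using D2 by (intro sum.cong) auto
  also have "\<dots> = measure lebesgue (\<Union>c\<in>D. case c of (u, v) \<Rightarrow> {u<..<v})"
    by (rule measure_UNION'[symmetric])
       (use D1 D3 in \<open>auto simp: disjoint_family_on_def pairwise_def disjnt_def lmeasurable_open\<close>)
  also have "\<dots> \<le> measure lebesgue T"
    by (rule measure_mono_fmeasurable) (use sub T(1) D1 in \<open>auto simp: split: prod.splits\<close>)
  finally have D4: "(\<Sum>(u, v)\<in>D. v - u) < \<delta>" using T(2) by simp
  have "(\<Sum>(s, K)\<in>q. \<bar>\<phi> (Sup K) - \<phi> (Inf K)\<bar>) = (\<Sum>(s, K)\<in>q'. \<bar>\<phi> (Sup K) - \<phi> (Inf K)\<bar>)"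
  proof (rule sum.mono_neutral_right[OF fin q'(2)], safe)
    fix s K assume "(s, K) \<in> q" "(s, K) \<notin> q'"
    moreover from this obtain u v where "K = {u..v}" "u \<le> v"
      using iv by blast
    ultimately show "\<bar>\<phi> (Sup K) - \<phi> (Inf K)\<bar> = 0"
      by (auto simp: q'_def)
  qed
  also have "\<dots> = (\<Sum>(u, v)\<in>D. \<bar>\<phi> v - \<phi> u\<bar>)"
    unfolding D_def by (subst sum.reindex[OF inj]) (auto simp: E_def intro!: sum.cong)
  also have "\<dots> < e" by (rule \<delta>) fact+
  finally show ?thesis .
qed

text \<open>
  The straddle lemma: an increment over an interval around \<open>s\<close> is approximated by the derivative at
  \<open>s\<close> up to an error proportional to the length, since both endpoints can be compared with \<open>s\<close>.
\<close>
lemma straddle: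
  fixes \<phi> :: "real \<Rightarrow> real"
  assumes "(\<phi> has_real_derivative D) (at s within {a..b})" and "\<eta> > 0"
  obtains d where "d > 0" and
    "\<And>u v. a \<le> u \<Longrightarrow> u \<le> s \<Longrightarrow> s \<le> v \<Longrightarrow> v \<le> b \<Longrightarrow> s - d < u \<Longrightarrow> v < s + d \<Longrightarrow>
       \<bar>(v - u) * D - (\<phi> v - \<phi> u)\<bar> \<le> \<eta> * (v - u)"
proof -
  from assms obtain d where d: "d > 0" and
    *: "\<And>y. y \<in> {a..b} \<Longrightarrow> \<bar>y - s\<bar> < d \<Longrightarrow> \<bar>\<phi> y - \<phi> s - D * (y - s)\<bar> \<le> \<eta> * \<bar>y - s\<bar>"
    unfolding has_field_derivative_def has_derivative_within_alt real_norm_def by metis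
  show ?thesis
  proof (rule that[OF d])
    fix u v assume uv: "a \<le> u" "u \<le> s" "s \<le> v" "v \<le> b" "s - d < u" "v < s + d"
    have "\<bar>\<phi> u - \<phi> s - D * (u - s)\<bar> \<le> \<eta> * (s - u)" "\<bar>\<phi> v - \<phi> s - D * (v - s)\<bar> \<le> \<eta> * (v - s)"
      using *[of u] *[of v] uv by auto
    then show "\<bar>(v - u) * D - (\<phi> v - \<phi> u)\<bar> \<le> \<eta> * (v - u)"
      by (simp add: algebra_simps abs_le_iff)
  qed
qed

text \<open>
  Choose the gauge differently on and off the exceptional set \<open>S\<close>.  At tags outside \<open>S\<close>, where \<open>\<phi>\<close> is
  differentiable, the straddle lemma bounds the error by a small multiple of the length.  At tags
  in \<open>S\<close> the gauge keeps the intervals inside an open set \<open>T \<supseteq> S\<close> of small measure, so absolute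
  continuity makes the total increment small; the Riemann sum has no terms there if \<open>\<phi>'\<close> is zero on
  \<open>S\<close>.
\<close>
lemma abs_cont_has_integral_zero_on_exceptions:
  fixes \<phi> \<phi>' :: "real \<Rightarrow> real"
  assumes "a \<le> b" and ac: "abs_cont_on a b \<phi>" and S: "negligible S"
    and der: "\<And>s. s \<in> {a..b} - S \<Longrightarrow> (\<phi> has_real_derivative \<phi>' s) (at s within {a..b})"
    and zero: "\<And>s. s \<in> S \<Longrightarrow> \<phi>' s = 0"
  shows "(\<phi>' has_integral (\<phi> b - \<phi> a)) {a..b}"
  unfolding has_integral_real
proof (intro allI impI)
  fix e :: real assume e: "e > 0"
  obtain \<delta> where "\<delta> > 0" and \<delta>: "\<And>D. finite D \<Longrightarrow> (\<forall>(u, v)\<in>D. a \<le> u \<and> u \<le> v \<and> v \<le> b) \<Longrightarrow>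
        disjoint_family_on (\<lambda>(u, v). {u<..<v}) D \<Longrightarrow> (\<Sum>(u, v)\<in>D. v - u) < \<delta> \<Longrightarrow>
        (\<Sum>(u, v)\<in>D. \<bar>\<phi> v - \<phi> u\<bar>) < e / 2"
    using ac[unfolded abs_cont_on_def, rule_format, of "e / 2"] e by fastforce
  obtain T where T: "open T" "S \<subseteq> T" "T \<in> lmeasurable" "measure lebesgue T < \<delta>"
  proof -
    obtain T where T: "open T" "S \<subseteq> T" "T - S \<in> lmeasurable" "emeasure lebesgue (T - S) < ennreal \<delta>"
      using sets_lebesgue_outer_open[OF negligible_imp_sets[OF S] \<open>\<delta> > 0\<close>] by metis
    have "S \<in> lmeasurable" "measure lebesgue S = 0"
      using S by (auto simp: negligible_iff_measure)
    moreover have "T = (T - S) \<union> S" using T(2) by auto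
    ultimately have "T \<in> lmeasurable" using T(3) by (metis fmeasurable.Un)
    moreover have "measure lebesgue T = measure lebesgue (T - S)"
      using S T(1) by (simp add: measure_Diff_null_set negligible_iff_null_sets)
    moreover have "measure lebesgue (T - S) < \<delta>"
      using T(3,4) \<open>\<delta> > 0\<close> by (simp add: emeasure_eq_measure2 ennreal_less_iff)
    ultimately show thesis using that T by metis
  qed
  \<comment> \<open>The summand \<open>1\<close> avoids division by zero when \<open>a = b\<close>.\<close>
  define \<eta> where "\<eta> = e / (2 * (b - a + 1))"
  have \<eta>: "\<eta> > 0" "\<eta> * (b - a) \<le> e / 2"
    using e \<open>a \<le> b\<close> by (auto simp: \<eta>_def field_simps)
  have "\<exists>d>0. (s \<in> {a..b} - S \<longrightarrow> (\<forall>u v. a \<le> u \<longrightarrow> u \<le> s \<longrightarrow> s \<le> v \<longrightarrow> v \<le> b \<longrightarrow>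
           s - d < u \<longrightarrow> v < s + d \<longrightarrow> \<bar>(v - u) * \<phi>' s - (\<phi> v - \<phi> u)\<bar> \<le> \<eta> * (v - u)))" for s
  proof (cases "s \<in> {a..b} - S")
    case True
    from straddle[OF der[OF True] \<eta>(1)] show ?thesis by metis
  qed (auto intro: exI[of _ 1])
  then obtain d where d: "\<And>s. d s > 0"
    "\<And>s u v. s \<in> {a..b} - S \<Longrightarrow> a \<le> u \<Longrightarrow> u \<le> s \<Longrightarrow> s \<le> v \<Longrightarrow> v \<le> b \<Longrightarrow>
           s - d s < u \<Longrightarrow> v < s + d s \<Longrightarrow> \<bar>(v - u) * \<phi>' s - (\<phi> v - \<phi> u)\<bar> \<le> \<eta> * (v - u)"
    by metis
  define \<gamma> where "\<gamma> s = (if s \<in> S then T else ball s (d s))" for s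
  have "gauge \<gamma>"
    using T(1,2) d(1) by (auto simp: gauge_def \<gamma>_def)
  moreover have "norm ((\<Sum>(s, K)\<in>p. measure lborel K *\<^sub>R \<phi>' s) - (\<phi> b - \<phi> a)) < e"
    if p: "p tagged_division_of {a..b}" and fine: "\<gamma> fine p" for p
  proof -
    define err where "err = (\<lambda>(s, K). measure lborel K * \<phi>' s - (\<phi> (Sup K) - \<phi> (Inf K)))"
    have fin: "finite p" using p by auto
    have iv: "\<exists>u v. K = {u..v} \<and> u \<le> s \<and> s \<le> v \<and> a \<le> u \<and> v \<le> b" if sK: "(s, K) \<in> p" for s K
    proof -
      obtain u v where "K = cbox u v" "s \<in> K" "K \<subseteq> {a..b}"
        using tagged_division_ofD[OF p] sK by metis
      then show ?thesis by (intro exI[of _ u] exI[of _ v]) auto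
    qed
    have sub: "K \<subseteq> \<gamma> s" if "(s, K) \<in> p" for s K
      using fine that by (auto simp: fine_def)
    define q where "q = {(s, K) \<in> p. s \<in> S}"
    have q: "q \<subseteq> p" by (auto simp: q_def)
    have "(\<Sum>c\<in>q. \<bar>err c\<bar>) = (\<Sum>(s, K)\<in>q. \<bar>\<phi> (Sup K) - \<phi> (Inf K)\<bar>)"
      by (intro sum.cong) (auto simp: q_def err_def zero)
    also have "\<dots> < e / 2"
      by (rule abs_cont_on_sum_tagged_lt[OF p q T(3,4) _ \<delta>])
         (use sub in \<open>fastforce simp: q_def \<gamma>_def\<close>)
    finally have I: "(\<Sum>c\<in>q. \<bar>err c\<bar>) < e / 2" .
    have "(\<Sum>c\<in>p - q. \<bar>err c\<bar>) \<le> (\<Sum>(s, K)\<in>p - q. \<eta> * (Sup K - Inf K))"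
    proof (rule sum_mono, safe)
      fix s K assume sK: "(s, K) \<in> p" "(s, K) \<notin> q"
      then obtain u v where uv: "K = {u..v}" "u \<le> s" "s \<le> v" "a \<le> u" "v \<le> b"
        using iv by metis
      have "s \<notin> S" using sK by (auto simp: q_def)
      then have "K \<subseteq> ball s (d s)" using sub[OF sK(1)] by (simp add: \<gamma>_def)
      moreover have "u \<in> K" "v \<in> K" using uv by auto
      ultimately have "s - d s < u" "v < s + d s"
        by (auto simp: dist_real_def subset_iff dest!: bspec)
      then show "\<bar>err (s, K)\<bar> \<le> \<eta> * (Sup K - Inf K)"
        using d(2)[of s u v] uv \<open>s \<notin> S\<close> by (auto simp: err_def)
    qed
    also have "\<dots> \<le> (\<Sum>(s, K)\<in>p. \<eta> * (Sup K - Inf K))"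
    proof (rule sum_mono2[OF fin Diff_subset])
      fix c assume "c \<in> p - (p - q)"
      then obtain s K where c: "c = (s, K)" "(s, K) \<in> p" by (cases c) auto
      then obtain u v where "K = {u..v}" "u \<le> s" "s \<le> v" using iv by metis
      then show "0 \<le> (case c of (s, K) \<Rightarrow> \<eta> * (Sup K - Inf K))"
        using \<eta>(1) by (simp add: c(1))
    qed
    also have "\<dots> = \<eta> * (\<Sum>(s, K)\<in>p. Sup K - Inf K)"
      by (simp add: sum_distrib_left case_prod_unfold)
    also have "(\<Sum>(s, K)\<in>p. Sup K - Inf K) = b - a"
      using additive_tagged_division_1[OF \<open>a \<le> b\<close> p, of "\<lambda>x. x"] by simp
    finally have II: "(\<Sum>c\<in>p - q. \<bar>err c\<bar>) \<le> e / 2" using \<eta>(2) by simp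
    have "(\<Sum>(s, K)\<in>p. measure lborel K *\<^sub>R \<phi>' s) - (\<phi> b - \<phi> a) = (\<Sum>c\<in>p. err c)"
      using additive_tagged_division_1[OF \<open>a \<le> b\<close> p, of \<phi>]
      by (simp add: err_def case_prod_unfold sum_subtractf)
    also have "norm \<dots> \<le> (\<Sum>c\<in>p. \<bar>err c\<bar>)" by simp
    also have "\<dots> = (\<Sum>c\<in>q. \<bar>err c\<bar>) + (\<Sum>c\<in>p - q. \<bar>err c\<bar>)"
      using sum.subset_diff[OF q fin] by (simp add: add.commute)
    also have "\<dots> < e" using I II by linarith
    finally show ?thesis .
  qed
  ultimately show "\<exists>\<gamma>. gauge \<gamma> \<and> (\<forall>p. p tagged_division_of {a..b} \<and> \<gamma> fine p \<longrightarrow>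
        norm ((\<Sum>(s, K)\<in>p. measure lborel K *\<^sub>R \<phi>' s) - (\<phi> b - \<phi> a)) < e)"
    by (intro exI[of _ \<gamma>]) simp
qed

text \<open>Changing the integrand on a negligible set does not affect the integral.\<close>
lemma abs_cont_has_integral:
  fixes \<phi> \<phi>' :: "real \<Rightarrow> real"
  assumes "a \<le> b" and "abs_cont_on a b \<phi>" and S: "negligible S"
    and der: "\<And>s. s \<in> {a..b} - S \<Longrightarrow> (\<phi> has_real_derivative \<phi>' s) (at s within {a..b})"
  shows "(\<phi>' has_integral (\<phi> b - \<phi> a)) {a..b}"
proof (rule has_integral_spike[OF S])
  show "((\<lambda>s. if s \<in> S then 0 else \<phi>' s) has_integral (\<phi> b - \<phi> a)) {a..b}"
    by (rule abs_cont_has_integral_zero_on_exceptions[OF assms(1-3)]) (use der in auto)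
qed auto

section \<open>Lipschitz bounds for vector fields on a box\<close>

lemma mem_Rn_iff: "z \<in> Rn n \<longleftrightarrow> (\<forall>j\<ge>n. z j = undefined)"
  by (auto simp: Rn_def PiE_iff extensional_def)

lemma fun_upd_in_Rn: "z \<in> Rn n \<Longrightarrow> j < n \<Longrightarrow> z(j := c) \<in> Rn n"
  by (simp add: mem_Rn_iff)

lemma sup_norm_le_iff: "n \<ge> 1 \<Longrightarrow> sup_norm n z \<le> c \<longleftrightarrow> (\<forall>i<n. \<bar>z i\<bar> \<le> c)"
  unfolding sup_norm_def by (subst Max_le_iff) (auto simp: lessThan_empty_iff)

text \<open>
  Scale \<open>u\<close> to the unit ball, and replace its values from index \<open>n\<close> on by \<open>undefined\<close>, to get a member of
  the set over which the induced norm is the supremum.  That supremum is an upper bound only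
  because the set is bounded, which the absolute row sums of \<open>A\<close> show.
\<close>
lemma abs_mat_vec_le:
  assumes n: "n \<ge> 1" and u: "\<And>j. j < n \<Longrightarrow> \<bar>u j\<bar> \<le> c" and i: "i < n"
  shows "\<bar>mat_vec n A u i\<bar> \<le> mat_norm n A * c"
proof -
  let ?U = "{u \<in> Rn n. sup_norm n u \<le> 1}"
  have "c \<ge> 0" using u[OF i] by linarith
  have bdd: "bdd_above ((\<lambda>u. sup_norm n (mat_vec n A u)) ` ?U)"
  proof (rule bdd_aboveI2)
    fix u assume "u \<in> ?U"
    then have u: "\<bar>u j\<bar> \<le> 1" if "j < n" for j
      using that sup_norm_le_iff[OF n] by blast
    have "\<bar>mat_vec n A u i\<bar> \<le> (\<Sum>i<n. \<Sum>j<n. \<bar>A i j\<bar>)" if "i < n" for i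
    proof -
      have "\<bar>mat_vec n A u i\<bar> \<le> (\<Sum>j<n. \<bar>A i j * u j\<bar>)"
        unfolding mat_vec_def by (rule sum_abs)
      also have "\<dots> \<le> (\<Sum>j<n. \<bar>A i j\<bar>)"
        by (intro sum_mono) (use u in \<open>auto simp: abs_mult intro: mult_left_le\<close>)
      also have "\<dots> \<le> (\<Sum>i<n. \<Sum>j<n. \<bar>A i j\<bar>)"
        using that by (intro member_le_sum) (auto intro: sum_nonneg)
      finally show ?thesis .
    qed
    then show "sup_norm n (mat_vec n A u) \<le> (\<Sum>i<n. \<Sum>j<n. \<bar>A i j\<bar>)"
      by (simp add: sup_norm_le_iff[OF n])
  qed
  show ?thesis
  proof (cases "c = 0")
    case True
    then have "mat_vec n A u i = 0" using u by (simp add: mat_vec_def)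
    then show ?thesis using True by simp
  next
    case False
    then have c: "c > 0" using \<open>c \<ge> 0\<close> by simp
    define u' where "u' = (\<lambda>j. if j < n then u j / c else undefined)"
    have "u' \<in> ?U"
      using u c by (auto simp: u'_def mem_Rn_iff sup_norm_le_iff[OF n])
    then have "sup_norm n (mat_vec n A u') \<le> mat_norm n A"
      unfolding mat_norm_def by (rule cSUP_upper[OF _ bdd])
    then have "\<bar>mat_vec n A u' i\<bar> \<le> mat_norm n A"
      using i by (simp add: sup_norm_le_iff[OF n])
    moreover have "mat_vec n A u' i = mat_vec n A u i / c"
      by (simp add: mat_vec_def u'_def sum_divide_distrib)
    ultimately show ?thesis using c by (simp add: field_simps)
  qed
qed

lemma mat_norm_nonneg: "n \<ge> 1 \<Longrightarrow> mat_norm n A \<ge> 0"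
  using abs_mat_vec_le[of n "\<lambda>_. 0" 1 0 A] by (simp add: mat_vec_def)

lemma tendsto_funI:
  fixes l :: "'a \<Rightarrow> 'b::topological_space"
  assumes "\<And>i. ((\<lambda>x. \<xi> x i) \<longlongrightarrow> l i) F"
  shows "(\<xi> \<longlongrightarrow> l) F"
proof -
  have "limitin (product_topology (\<lambda>i. euclidean) UNIV) \<xi> l F"
    using assms by (simp add: limitin_componentwise)
  then show ?thesis by (simp add: euclidean_product_topology)
qed

lemma C1_field_partial_MVT:
  assumes F: "C1_field n F" and z: "z \<in> Rn n" and ij: "i < n" "j < n"
  obtains c where "\<bar>c - z j\<bar> \<le> \<bar>h\<bar>"
    and "F (z(j := z j + h)) i - F z i = h * Jacobian F (z(j := c)) i j"
proof -
  define \<psi> where "\<psi> = (\<lambda>s. F (z(j := s)) i)"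
  have der: "(\<psi> has_real_derivative Jacobian F (z(j := s)) i j) (at s)" for s
  proof -
    have "z(j := s) \<in> Rn n" using z ij(2) by (rule fun_upd_in_Rn)
    then have "\<psi> differentiable (at s)"
      using F ij unfolding C1_field_def \<psi>_def by fastforce
    then show ?thesis
      by (simp add: Jacobian_def \<psi>_def DERIV_deriv_iff_real_differentiable)
  qed
  have "\<exists>c. \<bar>c - z j\<bar> \<le> \<bar>h\<bar> \<and> \<psi> (z j + h) - \<psi> (z j) = h * Jacobian F (z(j := c)) i j"
  proof (cases h "0::real" rule: linorder_cases)
    case greater
    then obtain c where "z j < c" "c < z j + h"
      "\<psi> (z j + h) - \<psi> (z j) = (z j + h - z j) * Jacobian F (z(j := c)) i j"
      using MVT2[of "z j" "z j + h" \<psi>] der by force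
    then show ?thesis using greater by (intro exI[of _ c]) auto
  next
    case less
    then obtain c where "z j + h < c" "c < z j"
      "\<psi> (z j) - \<psi> (z j + h) = (z j - (z j + h)) * Jacobian F (z(j := c)) i j"
      using MVT2[of "z j + h" "z j" \<psi>] der by force
    then show ?thesis using less by (intro exI[of _ c]) auto
  qed (auto intro: exI[of _ "z j"])
  then show ?thesis using that by (auto simp: \<psi>_def)
qed

text \<open>
  The chain rule along a line, from the existence and continuity of the partial derivatives: pass
  from \<open>p t\<close> to \<open>p (t + h)\<close> through points \<open>P k h\<close> whose first \<open>k\<close> coordinates have already moved.  Each
  step changes one coordinate, so the mean value theorem gives a partial derivative at some
  \<open>\<xi> k h\<close>, and \<open>\<xi> k h\<close> tends to \<open>p t\<close> as \<open>h\<close> tends to \<open>0\<close>.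
\<close>
lemma C1_field_derivative_along_line:
  fixes z d :: "nat \<Rightarrow> real"
  assumes F: "C1_field n F" and i: "i < n"
  defines "p \<equiv> \<lambda>t j. if j < n then z j + t * d j else undefined"
  shows "((\<lambda>t. F (p t) i) has_real_derivative mat_vec n (Jacobian F (p t)) d i) (at t)"
proof -
  define P where "P k h j = (if j < k then p (t + h) j else p t j)" for k :: nat and h j
  have pRn: "p s \<in> Rn n" for s by (simp add: mem_Rn_iff p_def)
  have PRn: "P k h \<in> Rn n" for k h
    by (simp add: mem_Rn_iff P_def p_def)
  have P0: "P 0 h = p t" for h by (auto simp: P_def)
  have Pn: "P n h = p (t + h)" for h by (auto simp: P_def p_def)
  have PSuc: "P (Suc k) h = (P k h)(k := P k h k + h * d k)" if "k < n" for k h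
    using that by (auto simp: P_def p_def fun_eq_iff less_Suc_eq algebra_simps)
  have "\<exists>c. \<bar>c - P k h k\<bar> \<le> \<bar>h * d k\<bar> \<and>
      F (P (Suc k) h) i - F (P k h) i = h * d k * Jacobian F ((P k h)(k := c)) i k" if "k < n" for k h
    using C1_field_partial_MVT[OF F PRn i that] PSuc[OF that] by metis
  then obtain c where c: "\<And>k h. k < n \<Longrightarrow> \<bar>c k h - P k h k\<bar> \<le> \<bar>h * d k\<bar>"
    "\<And>k h. k < n \<Longrightarrow> F (P (Suc k) h) i - F (P k h) i
        = h * d k * Jacobian F ((P k h)(k := c k h)) i k"
    by metis
  define \<xi> where "\<xi> k h = (P k h)(k := c k h)" for k h
  have \<xi>Rn: "\<xi> k h \<in> Rn n" if "k < n" for k h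
    unfolding \<xi>_def using PRn that by (rule fun_upd_in_Rn)
  have \<xi>_lim: "(\<xi> k \<longlongrightarrow> p t) (at 0)" if k: "k < n" for k
  proof (rule tendsto_funI)
    fix j
    have lim: "((\<lambda>h. h * d j) \<longlongrightarrow> 0) (at 0)"
      by (rule tendsto_mult_left_zero) (rule tendsto_ident_at)
    have "\<bar>\<xi> k h j - p t j\<bar> \<le> \<bar>h * d j\<bar>" for h
    proof (cases "j = k")
      case True
      then show ?thesis using c(1)[OF k, of h] by (simp add: \<xi>_def P_def)
    next
      case False
      then show ?thesis by (simp add: \<xi>_def P_def p_def algebra_simps)
    qed
    then have "((\<lambda>h. \<xi> k h j - p t j) \<longlongrightarrow> 0) (at 0)"
      by (intro tendsto_0_le[OF lim, of _ 1] always_eventually) simp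
    then show "((\<lambda>h. \<xi> k h j) \<longlongrightarrow> p t j) (at 0)"
      by (rule LIM_zero_cancel)
  qed
  have J_lim: "((\<lambda>h. Jacobian F (\<xi> k h) i k) \<longlongrightarrow> Jacobian F (p t) i k) (at 0)" if k: "k < n" for k
  proof (rule continuous_on_tendsto_compose[OF _ \<xi>_lim[OF k] pRn])
    show "continuous_on (Rn n) (\<lambda>z. Jacobian F z i k)"
      using F i k by (auto simp: C1_field_def)
  qed (use \<xi>Rn[OF k] in auto)
  have "((\<lambda>h. \<Sum>k<n. Jacobian F (\<xi> k h) i k * d k) \<longlongrightarrow> mat_vec n (Jacobian F (p t)) d i) (at 0)"
    unfolding mat_vec_def by (intro tendsto_sum tendsto_mult_right J_lim) simp
  moreover have "\<forall>\<^sub>F h in at 0. (\<Sum>k<n. Jacobian F (\<xi> k h) i k * d k) = (F (p (t + h)) i - F (p t) i) / h"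
  proof (rule eventually_at_filter[THEN iffD2], rule always_eventually, intro allI impI)
    fix h :: real assume h: "h \<noteq> 0"
    have "F (p (t + h)) i - F (p t) i = (\<Sum>k<n. F (P (Suc k) h) i - F (P k h) i)"
      using sum_lessThan_telescope[of "\<lambda>k. F (P k h) i" n] by (simp add: P0 Pn)
    also have "\<dots> = (\<Sum>k<n. h * (Jacobian F (\<xi> k h) i k * d k))"
      by (intro sum.cong) (auto simp: c(2) \<xi>_def)
    finally show "(\<Sum>k<n. Jacobian F (\<xi> k h) i k * d k) = (F (p (t + h)) i - F (p t) i) / h"
      using h by (simp add: sum_distrib_left[symmetric])
  qed
  ultimately show ?thesis
    unfolding DERIV_def by (rule Lim_transform_eventually)
qed

text \<open>
  Boxes are convex, so the segment from \<open>z'\<close> to \<open>z\<close> stays in \<open>B\<close>.  The mean value theorem for the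
  \<open>i\<close>-th component along it involves the Jacobian at a single point, and thus its induced norm.
\<close>
lemma C1_field_Lipschitz_on_box:
  assumes n: "n \<ge> 1" and F: "C1_field n F" and B: "is_box n B"
    and J: "\<And>z. z \<in> B \<Longrightarrow> mat_norm n (Jacobian F z) \<le> M"
    and z: "z \<in> B" "z' \<in> B" and c: "\<And>j. j < n \<Longrightarrow> \<bar>z j - z' j\<bar> \<le> c" and i: "i < n"
  shows "\<bar>F z i - F z' i\<bar> \<le> M * c"
proof -
  from B obtain lo hi where B_eq: "B = (\<Pi>\<^sub>E i\<in>{..<n}. {lo i..hi i})"
    unfolding is_box_def by blast
  define d where "d j = z j - z' j" for j
  define p where "p t j = (if j < n then z' j + t * d j else undefined)" for t j
  have p01: "p 0 = z'" "p 1 = z"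
  proof -
    have "z j = undefined" "z' j = undefined" if "\<not> j < n" for j
      using PiE_arb[OF z(1)[unfolded B_eq], of j] PiE_arb[OF z(2)[unfolded B_eq], of j] that
      by (metis lessThan_iff)+
    then show "p 0 = z'" "p 1 = z"
      unfolding fun_eq_iff by (simp_all add: p_def d_def)
  qed
  have pB: "p t \<in> B" if "0 \<le> t" "t \<le> 1" for t
  proof -
    have "p t j \<in> {lo j..hi j}" if "j < n" for j
    proof -
      have "z j \<in> {lo j..hi j}" "z' j \<in> {lo j..hi j}" 
        using PiE_mem[OF z(1)[unfolded B_eq], of j] PiE_mem[OF z(2)[unfolded B_eq], of j] that
        by (metis lessThan_iff)+
      moreover have "p t j = (1 - t) *\<^sub>R z' j + t *\<^sub>R z j"
        using that by (simp add: p_def d_def algebra_simps)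
      moreover have "convex {lo j..hi j}" by simp
      ultimately show ?thesis
        using convexD[of "{lo j..hi j}" "z' j" "z j" "1 - t" t] \<open>0 \<le> t\<close> \<open>t \<le> 1\<close> by auto
    qed
    moreover have "p t j = undefined" if "j \<notin> {..<n}" for j
      using that by (simp add: p_def)
    ultimately show ?thesis unfolding B_eq by (intro PiE_I) auto
  qed
  have "((\<lambda>t. F (p t) i) has_real_derivative mat_vec n (Jacobian F (p t)) d i) (at t)" for t
    using C1_field_derivative_along_line[OF F i, of z' d t] unfolding p_def .
  then obtain t where t: "0 < t" "t < 1" "F (p 1) i - F (p 0) i = (1 - 0) * mat_vec n (Jacobian F (p t)) d i"
    using MVT2[of 0 1 "\<lambda>t. F (p t) i" "\<lambda>t. mat_vec n (Jacobian F (p t)) d i"] by auto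
  have "c \<ge> 0" using c[OF i] by linarith
  have "\<bar>F z i - F z' i\<bar> = \<bar>mat_vec n (Jacobian F (p t)) d i\<bar>" using t(3) p01 by simp
  also have "\<dots> \<le> mat_norm n (Jacobian F (p t)) * c"
    by (rule abs_mat_vec_le[OF n _ i]) (use c in \<open>auto simp: d_def\<close>)
  also have "\<dots> \<le> M * c"
    using J[OF pB] t \<open>c \<ge> 0\<close> by (intro mult_right_mono) auto
  finally show ?thesis .
qed

section \<open>The local error of one step\<close>

definition velocity where
  "velocity m f g v x s j = f (x s) j + (\<Sum>i=1..m. g i (x s) j * v i s)"
  for f :: "(nat \<Rightarrow> real) \<Rightarrow> nat \<Rightarrow> real" and g :: "nat \<Rightarrow> (nat \<Rightarrow> real) \<Rightarrow> nat \<Rightarrow> real"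
    and v :: "nat \<Rightarrow> real \<Rightarrow> real" and x :: "real \<Rightarrow> nat \<Rightarrow> real"

lemma solves_on_has_integral:
  assumes sol: "solves_on n m f g v a b x" and s: "s \<in> {a..b}" and j: "j < n"
  shows "((\<lambda>\<tau>. velocity m f g v x \<tau> j) has_integral (x s j - x a j)) {a..s}"
proof -
  have "AE \<tau> in lebesgue. \<tau> \<in> {a..b} \<longrightarrow>
      (\<forall>j<n. ((\<lambda>\<tau>. x \<tau> j) has_real_derivative velocity m f g v x \<tau> j) (at \<tau> within {a..b}))"
    using sol unfolding solves_on_def velocity_def by (simp add: AE_restrict_space_iff)
  then obtain S where S: "negligible S" and der: "\<And>\<tau> j. \<tau> \<in> {a..b} - S \<Longrightarrow> j < n \<Longrightarrow>
      ((\<lambda>\<tau>. x \<tau> j) has_real_derivative velocity m f g v x \<tau> j) (at \<tau> within {a..b})"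
    unfolding eventually_ae_filter negligible_iff_null_sets by auto
  show ?thesis
  proof (rule abs_cont_has_integral[OF _ _ S])
    show "abs_cont_on a s (\<lambda>\<tau>. x \<tau> j)"
    proof (rule abs_cont_on_subinterval)
      show "abs_cont_on a b (\<lambda>\<tau>. x \<tau> j)"
        using sol j unfolding solves_on_def by blast
    qed (use s in simp_all)
    show "((\<lambda>\<tau>. x \<tau> j) has_real_derivative velocity m f g v x \<tau> j) (at \<tau> within {a..s})"
      if "\<tau> \<in> {a..s} - S" for \<tau>
      by (rule has_field_derivative_subset[OF der]) (use that s j in auto)
  qed (use s in simp)
qed

lemma abs_velocity_le:
  assumes "\<bar>f (x s) j\<bar> \<le> K" and "\<And>i. i \<in> {1..m} \<Longrightarrow> \<bar>g i (x s) j\<bar> \<le> Kg i"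
    and "\<And>i. i \<in> {1..m} \<Longrightarrow> \<bar>v i s\<bar> \<le> V i"
  shows "\<bar>velocity m f g v x s j\<bar> \<le> K + (\<Sum>i=1..m. Kg i * V i)"
proof -
  have "\<bar>\<Sum>i=1..m. g i (x s) j * v i s\<bar> \<le> (\<Sum>i=1..m. \<bar>g i (x s) j * v i s\<bar>)"
    by (rule sum_abs)
  also have "\<dots> \<le> (\<Sum>i=1..m. Kg i * V i)"
  proof (rule sum_mono)
    fix i assume "i \<in> {1..m}"
    then show "\<bar>g i (x s) j * v i s\<bar> \<le> Kg i * V i"
      unfolding abs_mult using assms(2,3)[of i] by (intro mult_mono) auto
  qed
  finally show ?thesis using assms(1) by (simp add: velocity_def)
qed

text \<open>
  The increment is the integral of the velocity, whose size is at most \<open>K + \<Sum>\<^sub>i Kg\<^sub>i V\<^sub>i\<close>.  A bound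
  uniform in \<open>s\<close> is what the pointwise estimates over the whole step use, hence \<open>b - a\<close> on the right.
\<close>
lemma solves_on_increment_le:
  assumes sol: "solves_on n m f g v a b x" and s: "s \<in> {a..b}" and j: "j < n"
    and f: "\<And>\<tau>. \<tau> \<in> {a..b} \<Longrightarrow> \<bar>f (x \<tau>) j\<bar> \<le> K"
    and g: "\<And>\<tau> i. \<tau> \<in> {a..b} \<Longrightarrow> i \<in> {1..m} \<Longrightarrow> \<bar>g i (x \<tau>) j\<bar> \<le> Kg i"
    and v: "\<And>\<tau> i. \<tau> \<in> {a..b} \<Longrightarrow> i \<in> {1..m} \<Longrightarrow> \<bar>v i \<tau>\<bar> \<le> V i"
  shows "\<bar>x s j - x a j\<bar> \<le> (K + (\<Sum>i=1..m. Kg i * V i)) * (b - a)"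
proof -
  let ?M = "K + (\<Sum>i=1..m. Kg i * V i)"
  have bd: "\<bar>velocity m f g v x \<tau> j\<bar> \<le> ?M" if "\<tau> \<in> {a..b}" for \<tau>
    by (rule abs_velocity_le) (use f g v that in auto)
  have M: "?M \<ge> 0" using bd[of s] s by linarith
  have "norm (x s j - x a j) \<le> ?M * measure lborel (cbox a s)"
    by (rule has_integral_bound[OF M])
       (use solves_on_has_integral[OF sol s j] bd s in auto)
  also have "\<dots> \<le> ?M * (b - a)" using s M by (intro mult_left_mono) auto
  finally show ?thesis by simp
qed

text \<open>
  Bounded measurable inputs are Lebesgue integrable, so the hypothesis on the Lebesgue integral of
  \<open>v - w\<close> says the same about its gauge integral.
\<close>
lemma is_input_has_integral_0:
  assumes "is_input a b V v" "is_input a b W w" "(LINT s:{a..b}|lebesgue. v s - w s) = 0"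
  shows "((\<lambda>s. v s - w s) has_integral 0) {a..b}"
proof -
  have "(\<lambda>s. v s - w s) absolutely_integrable_on {a..b}"
  proof (rule measurable_bounded_by_integrable_imp_absolutely_integrable)
    show "(\<lambda>s. v s - w s) \<in> borel_measurable (lebesgue_on {a..b})"
      using assms by (auto simp: is_input_def)
    show "norm (v s - w s) \<le> V + W" if "s \<in> {a..b}" for s
    proof -
      have "\<bar>v s\<bar> \<le> V" "\<bar>w s\<bar> \<le> W" using assms that by (auto simp: is_input_def)
      then show ?thesis by (simp add: abs_le_iff)
    qed
  qed auto
  from has_integral_set_lebesgue[OF this] assms(3) show ?thesis by simp
qed

text \<open>
  \<open>Mx\<close> and \<open>My\<close> bound the speeds of \<open>x\<close> and \<open>y\<close>.  The integrand \<open>R\<close> is the difference of the two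
  velocities minus the terms \<open>g\<^sub>i(x(a)) (v\<^sub>i - w\<^sub>i)\<close>; subtracting these leaves the integral unchanged
  but makes the integrand \<open>O(b - a)\<close>.
\<close>
lemma local_error_component:
  fixes m :: nat and K :: real and V W Kg Lg :: "nat \<Rightarrow> real"
  defines "Mx \<equiv> K + (\<Sum>i=1..m. Kg i * V i)" and "My \<equiv> K + (\<Sum>i=1..m. Kg i * W i)"
  assumes ab: "a \<le> b" and n: "1 \<le> n" and j: "j < n"
    and Cf: "C1_field n f" and Cg: "\<And>i. i \<in> {1..m} \<Longrightarrow> C1_field n (g i)" and B: "is_box n B"
    and f: "\<And>z. z \<in> B \<Longrightarrow> sup_norm n (f z) \<le> K"
      "\<And>z. z \<in> B \<Longrightarrow> mat_norm n (Jacobian f z) \<le> L"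
    and g: "\<And>z i. z \<in> B \<Longrightarrow> i \<in> {1..m} \<Longrightarrow> sup_norm n (g i z) \<le> Kg i"
      "\<And>z i. z \<in> B \<Longrightarrow> i \<in> {1..m} \<Longrightarrow> mat_norm n (Jacobian (g i) z) \<le> Lg i"
    and v: "\<And>i. i \<in> {1..m} \<Longrightarrow> is_input a b (V i) (v i)"
    and w: "\<And>i. i \<in> {1..m} \<Longrightarrow> is_input a b (W i) (w i)"
    and vw: "\<And>i. i \<in> {1..m} \<Longrightarrow> (LINT s:{a..b}|lebesgue. v i s - w i s) = 0"
    and x: "solves_on n m f g v a b x" and y: "solves_on n m f g w a b y"
    and init: "x a = y a" and inB: "\<And>s. s \<in> {a..b} \<Longrightarrow> x s \<in> B" "\<And>s. s \<in> {a..b} \<Longrightarrow> y s \<in> B"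
  shows "\<bar>x b j - y b j\<bar> \<le> (L * (Mx + My) + (\<Sum>i=1..m. Lg i * (Mx * V i + My * W i))) * (b - a)\<^sup>2"
proof -
  define h where "h = b - a"
  have vb: "\<bar>v i s\<bar> \<le> V i" and wb: "\<bar>w i s\<bar> \<le> W i" if "i \<in> {1..m}" "s \<in> {a..b}" for i s
    using v w that by (auto simp: is_input_def)
  have fb: "\<bar>f z l\<bar> \<le> K" if "z \<in> B" "l < n" for z l
    using f(1) that sup_norm_le_iff[OF n] by blast
  have gb: "\<bar>g i z l\<bar> \<le> Kg i" if "z \<in> B" "i \<in> {1..m}" "l < n" for z i l
    using g(1) that sup_norm_le_iff[OF n] by blast
  have dx: "\<bar>x s l - x a l\<bar> \<le> Mx * h" if "s \<in> {a..b}" "l < n" for s l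
    unfolding Mx_def h_def
    by (rule solves_on_increment_le[OF x that]) (use fb gb vb inB that in auto)
  have dy: "\<bar>y s l - x a l\<bar> \<le> My * h" if "s \<in> {a..b}" "l < n" for s l
    unfolding My_def h_def init
    by (rule solves_on_increment_le[OF y that]) (use fb gb wb inB that in auto)
  define R where "R s = velocity m f g v x s j - velocity m f g w y s j
      - (\<Sum>i=1..m. g i (x a) j * (v i s - w i s))" for s
  define C where "C = L * (Mx + My) + (\<Sum>i=1..m. Lg i * (Mx * V i + My * W i))"
  have "(R has_integral (x b j - x a j) - (y b j - y a j) - (\<Sum>i=1..m. g i (x a) j * 0)) {a..b}"
    unfolding R_def
    by (intro has_integral_diff has_integral_sum has_integral_mult_right
          solves_on_has_integral[OF x] solves_on_has_integral[OF y] is_input_has_integral_0[OF v w vw])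
       (use ab j in auto)
  then have R_int: "(R has_integral (x b j - y b j)) (cbox a b)"
    by (simp add: init)
  have R_bound: "\<bar>R s\<bar> \<le> C * h" if s: "s \<in> {a..b}" for s
  proof -
    have xa: "x a \<in> B" using inB(1)[of a] ab by simp
    have 1: "\<bar>f (x s) j - f (y s) j\<bar> \<le> L * ((Mx + My) * h)"
    proof (rule C1_field_Lipschitz_on_box[OF n Cf B f(2) inB(1) inB(2) _ j])
      show "\<bar>x s l - y s l\<bar> \<le> (Mx + My) * h" if "l < n" for l
        using dx[OF s that] dy[OF s that] by (simp add: distrib_right)
    qed (use s in auto)
    have gx: "\<bar>g i (x s) j - g i (x a) j\<bar> \<le> Lg i * (Mx * h)" if "i \<in> {1..m}" for i
      by (rule C1_field_Lipschitz_on_box[OF n Cg B g(2) inB(1) xa _ j]) (use that s dx in auto)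
    have gy: "\<bar>g i (y s) j - g i (x a) j\<bar> \<le> Lg i * (My * h)" if "i \<in> {1..m}" for i
      by (rule C1_field_Lipschitz_on_box[OF n Cg B g(2) inB(2) xa _ j]) (use that s dy in auto)
    have R_eq: "R s = (f (x s) j - f (y s) j) + (\<Sum>i=1..m.
        (g i (x s) j - g i (x a) j) * v i s - (g i (y s) j - g i (x a) j) * w i s)"
      by (simp add: R_def velocity_def sum.distrib sum_subtractf algebra_simps)
    \<comment> \<open>Each input is merely bounded, but it multiplies an increment of \<open>g\<^sub>i\<close>, which is \<open>O(h)\<close>.\<close>
    have "\<bar>\<Sum>i=1..m. (g i (x s) j - g i (x a) j) * v i s - (g i (y s) j - g i (x a) j) * w i s\<bar>
        \<le> (\<Sum>i=1..m. Lg i * (Mx * V i + My * W i) * h)"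
    proof (rule order_trans[OF sum_abs sum_mono])
      fix i assume i: "i \<in> {1..m}"
      have "\<bar>(g i (x s) j - g i (x a) j) * v i s\<bar> \<le> Lg i * (Mx * h) * V i"
        unfolding abs_mult using gx[OF i] vb[OF i s] by (intro mult_mono) auto
      moreover have "\<bar>(g i (y s) j - g i (x a) j) * w i s\<bar> \<le> Lg i * (My * h) * W i"
        unfolding abs_mult using gy[OF i] wb[OF i s] by (intro mult_mono) auto
      ultimately show "\<bar>(g i (x s) j - g i (x a) j) * v i s - (g i (y s) j - g i (x a) j) * w i s\<bar>
          \<le> Lg i * (Mx * V i + My * W i) * h"
        by (simp add: algebra_simps)
    qed
    with 1 show ?thesis
      unfolding R_eq C_def by (simp add: distrib_right sum_distrib_right mult.assoc)
  qed
  have Ch: "C * h \<ge> 0" using R_bound[of a] ab by force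
  have "norm (x b j - y b j) \<le> C * h * measure lborel (cbox a b)"
    by (rule has_integral_bound[OF Ch R_int]) (use R_bound in auto)
  then show ?thesis using ab by (simp add: C_def h_def power2_eq_square mult.assoc)
qed

lemma is_partition_mono:
  assumes "is_partition T N t" "i \<le> j" "j \<le> N"
  shows "t i \<le> t j"
  using assms(2,3)
proof (induction j rule: dec_induct)
  case (step k)
  then have "t i \<le> t k" "t k < t (Suc k)"
    using assms(1) by (simp_all add: is_partition_def)
  then show ?case by simp
qed simp

theorem theorem6:
  fixes m :: nat and T r K L :: real and V Kg Lg :: "nat \<Rightarrow> real"
  assumes "\<forall>i\<in>{1..m}. V i > 0"
  shows "\<exists>C::real. \<forall>n f g B N t k v w x y.
      1 \<le> n \<longrightarrow>
      C1_field n f \<longrightarrow>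
      (\<forall>i\<in>{1..m}. C1_field n (g i)) \<longrightarrow>
      is_box n B \<longrightarrow>
      (\<forall>z\<in>B. sup_norm n (f z) \<le> K \<and> mat_norm n (Jacobian f z) \<le> L \<and>
        (\<forall>i\<in>{1..m}. sup_norm n (g i z) \<le> Kg i \<and> mat_norm n (Jacobian (g i) z) \<le> Lg i)) \<longrightarrow>
      is_partition T N t \<longrightarrow>
      k < N \<longrightarrow>
      (\<forall>i\<in>{1..m}. is_input 0 T (V i) (v i)) \<longrightarrow>
      (\<forall>i\<in>{1..m}. is_input (t k) (t (Suc k)) (r * V i) (w i)) \<longrightarrow>
      (\<forall>i\<in>{1..m}. (LINT s:{t k..t (Suc k)}|lebesgue. v i s - w i s) = 0) \<longrightarrow>
      solves_on n m f g v (t k) (t (Suc k)) x \<longrightarrow>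
      solves_on n m f g w (t k) (t (Suc k)) y \<longrightarrow>
      x (t k) = y (t k) \<longrightarrow>
      (\<forall>s\<in>{t k..t (Suc k)}. x s \<in> B \<and> y s \<in> B) \<longrightarrow>
      sup_norm n (\<lambda>j. x (t (Suc k)) j - y (t (Suc k)) j) \<le> C * (t (Suc k) - t k)\<^sup>2"
proof (intro exI allI impI)
  define Mx My where "Mx = K + (\<Sum>i=1..m. Kg i * V i)" and "My = K + (\<Sum>i=1..m. Kg i * (r * V i))"
  fix n f g B N t k v w x y
  assume n: "1 \<le> n" and C1: "C1_field n f" "\<forall>i\<in>{1..m}. C1_field n (g i)" and B: "is_box n B"
    and bounds: "\<forall>z\<in>B. sup_norm n (f z) \<le> K \<and> mat_norm n (Jacobian f z) \<le> L \<and>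
        (\<forall>i\<in>{1..m}. sup_norm n (g i z) \<le> Kg i \<and> mat_norm n (Jacobian (g i) z) \<le> Lg i)"
    and part: "is_partition T N t" and k: "k < N"
    and v: "\<forall>i\<in>{1..m}. is_input 0 T (V i) (v i)"
    and w: "\<forall>i\<in>{1..m}. is_input (t k) (t (Suc k)) (r * V i) (w i)"
    and vw: "\<forall>i\<in>{1..m}. (LINT s:{t k..t (Suc k)}|lebesgue. v i s - w i s) = 0"
    and sol: "solves_on n m f g v (t k) (t (Suc k)) x" "solves_on n m f g w (t k) (t (Suc k)) y"
    and init: "x (t k) = y (t k)" and inB: "\<forall>s\<in>{t k..t (Suc k)}. x s \<in> B \<and> y s \<in> B"
  have "t 0 \<le> t k" "t k \<le> t (Suc k)" "t (Suc k) \<le> t N"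
    using k by (auto intro: is_partition_mono[OF part])
  moreover have "t 0 = 0" "t N = T"
    using part by (auto simp: is_partition_def)
  ultimately have step: "t k \<le> t (Suc k)" and sub: "{t k..t (Suc k)} \<subseteq> {0..T}"
    by auto
  have v': "is_input (t k) (t (Suc k)) (V i) (v i)" if "i \<in> {1..m}" for i
    unfolding is_input_def
  proof (intro conjI ballI)
    have vi: "is_input 0 T (V i) (v i)" using v that by blast
    then show "v i \<in> borel_measurable (lebesgue_on {t k..t (Suc k)})"
      unfolding is_input_def by (blast intro: measurable_restrict_mono[OF _ sub])
    show "\<bar>v i s\<bar> \<le> V i" if "s \<in> {t k..t (Suc k)}" for s
      using vi that sub unfolding is_input_def by blast
  qed
  have "\<bar>x (t (Suc k)) j - y (t (Suc k)) j\<bar>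
      \<le> (L * (Mx + My) + (\<Sum>i=1..m. Lg i * (Mx * V i + My * (r * V i)))) * (t (Suc k) - t k)\<^sup>2"
    if j: "j < n" for j
    unfolding Mx_def My_def
    by (rule local_error_component[OF step n j C1(1) _ B _ _ _ _ v' _ _ sol init])
       (use C1(2) bounds w vw inB in auto)
  then show "sup_norm n (\<lambda>j. x (t (Suc k)) j - y (t (Suc k)) j)
      \<le> (L * (Mx + My) + (\<Sum>i=1..m. Lg i * (Mx * V i + My * (r * V i)))) * (t (Suc k) - t k)\<^sup>2"
    by (simp add: sup_norm_le_iff[OF n])
qed

end
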